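(* Let $(x_k)_{k\ge 1}$ be a Schauder basic sequence in a Banach lattice $X$. The following are equivalent: (1) for every sequence of scalars $(\alpha_k)$ and every $x\in X$: if $\sum_{k=1}^n\alpha_kx_k\to x$ in norm, then $\sum_{k=1}^n\alpha_kx_k\to x$ uniformly; (2) for every sequence of scalars $(\alpha_k)$ and every $x\in X$: if $\sum_{k=1}^n\alpha_kx_k\to x$ in norm, then $\sum_{k=1}^n\alpha_kx_k\to x$ in $\sigma$-order; (3) for every sequence of scalars $(\alpha_k)$ and every $x\in X$: if $\sum_{k=1}^n\alpha_kx_k\to x$ in norm, then $\sum_{k=1}^n\alpha_kx_k\to x$ in order; (4) if $\sum_{k=1}^\infty\alpha_kx_k$ converges in norm, then the sequence of its partial sums $\bigl(\sum_{k=1}^n\alpha_kx_k\bigr)_n$ is order bounded in $X$; (5) if $\sum_{k=1}^\infty\alpha_kx_k$ converges in norm, then the sequence $\Bigl(\bigvee_{n=1}^m\bigl|\sum_{k=1}^n\alpha_kx_k\bigr|\Bigr)_{m=1}^\infty$ is norm bounded; (6) there exists $M\ge 1$ such that for all $m\in\mathbb N$ and all $\alpha_1,\dots,\alpha_m\in\mathbb R$, $$\Bigl\|\bigvee_{n=1}^m\Bigl|\sum_{k=1}^n\alpha_kx_k\Bigr|\Bigr\|\le M\Bigl\|\sum_{k=1}^m\alpha_kx_k\Bigr\|.$$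
   Context: A sequence $(x_k)$ in a Banach space is (Schauder) basic if it is a Schauder basis of its closed linear span $[x_k]$. The closed span $[x_k]$ is not assumed to be a sublattice of $X$. Convergences in an Archimedean vector lattice $X$ (here for sequences $(z_n)$): - $z_n\to z$ uniformly if there is $e\in X_+$ such that for every $\varepsilon>0$ there is $n_0$ with $|z_n-z|\le\varepsilon e$ for all $n\ge n_0$. - $z_n\to z$ in order if there is a net $(u_\gamma)$ (with a possibly different index set) with $u_\gamma\downarrow 0$ such that for every $\gamma$ there is $n_0$ with $|z_n-z|\le u_\gamma$ for all $n\ge n_0$. - $z_n\to z$ in $\sigma$-order if there is a sequence $(u_n)$ with $u_n\downarrow 0$ and $|z_n-z|\le u_n$ for every $n$. *)

theory Defs
  imports "HOL-Analysis.Analysis" "HOL-Library.Lattice_Algebras"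
begin

class banach_lattice = banach + lattice_ab_group_add_abs + ordered_real_vector +
  assumes norm_mono_abs: "\<bar>x\<bar> \<le> \<bar>y\<bar> \<Longrightarrow> norm x \<le> norm y"

definition basic_sequence :: "(nat \<Rightarrow> 'a::banach) \<Rightarrow> bool" where
  "basic_sequence x \<longleftrightarrow>
     (\<forall>y \<in> closure (span (range x)). \<exists>!\<alpha>::nat \<Rightarrow> real. (\<lambda>k. \<alpha> k *\<^sub>R x k) sums y)"

definition is_infimum :: "'a::order set \<Rightarrow> 'a \<Rightarrow> bool" where
  "is_infimum A l \<longleftrightarrow> (\<forall>a\<in>A. l \<le> a) \<and> (\<forall>b. (\<forall>a\<in>A. b \<le> a) \<longrightarrow> b \<le> l)"

text \<open>A pair \<open>(i, j) \<in> r\<close> means that \<open>j\<close> is a later index than \<open>i\<close>.\<close>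

definition net_decreases_to :: "'i set \<Rightarrow> 'i rel \<Rightarrow> ('i \<Rightarrow> 'a::order) \<Rightarrow> 'a \<Rightarrow> bool" where
  "net_decreases_to I r u l \<longleftrightarrow>
     I \<noteq> {} \<and> preorder_on I r \<and>
     (\<forall>i\<in>I. \<forall>j\<in>I. \<exists>k\<in>I. (i, k) \<in> r \<and> (j, k) \<in> r) \<and>
     (\<forall>i j. (i, j) \<in> r \<longrightarrow> u j \<le> u i) \<and>
     is_infimum (u ` I) l"

definition uniformly_converges :: "(nat \<Rightarrow> 'a::banach_lattice) \<Rightarrow> 'a \<Rightarrow> bool" where
  "uniformly_converges z l \<longleftrightarrow>
     (\<exists>e\<ge>0. \<forall>\<epsilon>::real. \<epsilon> > 0 \<longrightarrow> (\<exists>n0. \<forall>n\<ge>n0. \<bar>z n - l\<bar> \<le> \<epsilon> *\<^sub>R e))"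

text \<open>
  HOL cannot quantify over index types inside a formula, so the index set of the dominating net
  is taken to be a subset of the space itself. This loses no generality: see
  \<open>order_convergesI_net\<close> below.
\<close>

definition order_converges :: "(nat \<Rightarrow> 'a::banach_lattice) \<Rightarrow> 'a \<Rightarrow> bool" where
  "order_converges z l \<longleftrightarrow>
     (\<exists>(I::'a set) r u. net_decreases_to I r u 0 \<and>
        (\<forall>i\<in>I. \<exists>n0. \<forall>n\<ge>n0. \<bar>z n - l\<bar> \<le> u i))"

definition sigma_order_converges :: "(nat \<Rightarrow> 'a::banach_lattice) \<Rightarrow> 'a \<Rightarrow> bool" where
  "sigma_order_converges z l \<longleftrightarrow>
     (\<exists>u. decseq u \<and> is_infimum (range u) 0 \<and> (\<forall>n. \<bar>z n - l\<bar> \<le> u n))"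

definition order_bounded :: "'a::order set \<Rightarrow> bool" where
  "order_bounded A \<longleftrightarrow> (\<exists>a b. A \<subseteq> {a..b})"

text \<open>
  Sequences start at index \<open>0\<close>, so \<open>x 0\<close> is the first term and \<open>partial_sum \<alpha> x n\<close>
  is the sum of the first \<open>n + 1\<close> terms.
\<close>

definition partial_sum :: "(nat \<Rightarrow> real) \<Rightarrow> (nat \<Rightarrow> 'a::real_vector) \<Rightarrow> nat \<Rightarrow> 'a" where
  "partial_sum \<alpha> x n = (\<Sum>k\<le>n. \<alpha> k *\<^sub>R x k)"

definition max_partial_sum :: "(nat \<Rightarrow> real) \<Rightarrow> (nat \<Rightarrow> 'a::banach_lattice) \<Rightarrow> nat \<Rightarrow> 'a" where
  "max_partial_sum \<alpha> x m = Sup_fin ((\<lambda>n. \<bar>partial_sum \<alpha> x n\<bar>) ` {..m})"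

definition all_equivalent :: "bool list \<Rightarrow> bool" where
  "all_equivalent Ps \<longleftrightarrow> (\<forall>P \<in> set Ps. \<forall>Q \<in> set Ps. P \<longleftrightarrow> Q)"

lemma order_convergesI_net:
  fixes z :: "nat \<Rightarrow> 'a::banach_lattice" and I :: "'i set"
  assumes net: "net_decreases_to I r u 0"
    and dom: "\<forall>i\<in>I. \<exists>n0. \<forall>n\<ge>n0. \<bar>z n - l\<bar> \<le> u i"
  shows "order_converges z l"
proof -
  define s where "s = {(a, b). a \<in> u ` I \<and> b \<in> u ` I \<and> b \<le> a}"
  have "net_decreases_to (u ` I) s (\<lambda>a. a) 0"
    unfolding net_decreases_to_def
  proof (intro conjI)
    show "u ` I \<noteq> {}" "is_infimum ((\<lambda>a. a) ` u ` I) 0"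
      using net by (auto simp: net_decreases_to_def)
    show "preorder_on (u ` I) s"
      by (auto simp: preorder_on_def refl_on_def trans_def s_def)
    show "\<forall>a\<in>u ` I. \<forall>b\<in>u ` I. \<exists>c\<in>u ` I. (a, c) \<in> s \<and> (b, c) \<in> s"
      using net unfolding net_decreases_to_def s_def by fast
    show "\<forall>a b. (a, b) \<in> s \<longrightarrow> b \<le> a"
      by (auto simp: s_def)
  qed
  with dom show ?thesis
    unfolding order_converges_def by blast
qed

end

theory Submission
  imports Defs
begin

text \<open>
  The step from (5) to (6) is a uniform boundedness argument on the closed span of \<open>x\<close>: the
  supremum of the norms in (5) is a countably subadditive seminorm of the limit, hence bounded by a
  multiple of its norm. For (6) to (1), apply (6) to blocks of the series between rapidly
  increasing indices: the block maxima have summable norms, even after multiplication by \<open>2 ^ i\<close>,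
  and their sum is the regulator of the uniform convergence.
\<close>

text \<open>The closed span need not be a sublattice, so the maxima of partial sums may leave it:
  the seminorm lives on the span, while its values are norms of elements of the whole lattice. Order
  and norm meet in two facts: the norm is monotone and the positive cone is closed. The second lets
  domination pass to infinite sums, which is where countable subadditivity comes from. The sublevel
  sets of the seminorm are not known to be closed, because its definition goes through the
  coefficients; only their closures enter the Baire argument, and countable subadditivity makes up
  for the difference. In the other direction, the point of (6) is that the norm of a single
  increment controls all intermediate sums of a block, so a rate of norm convergence along a
  subsequence becomes an order bound for the full sequence.\<close>

section \<open>Norm and order in a Banach lattice\<close>

lemma norm_abs_banach_lattice [simp]: "norm \<bar>a\<bar> = norm (a::'a::banach_lattice)"
  by (intro antisym norm_mono_abs) auto

lemma norm_le_if_abs_le: "\<bar>a\<bar> \<le> b \<Longrightarrow> norm a \<le> norm (b::'a::banach_lattice)"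
  by (rule norm_mono_abs) (metis abs_ge_self order_trans)

lemma abs_scaleR_le:
  fixes a :: "'a::banach_lattice"
  shows "\<bar>c *\<^sub>R a\<bar> \<le> \<bar>c\<bar> *\<^sub>R \<bar>a\<bar>"
proof -
  have "\<bar>c\<bar> *\<^sub>R a \<le> \<bar>c\<bar> *\<^sub>R \<bar>a\<bar>" "\<bar>c\<bar> *\<^sub>R (- a) \<le> \<bar>c\<bar> *\<^sub>R \<bar>a\<bar>"
    by (intro scaleR_left_mono; simp add: abs_ge_self abs_ge_minus_self)+
  then show ?thesis
    by (cases "c \<ge> 0") (auto intro!: abs_leI)
qed

text \<open>The negative part \<open>sup (- l) 0\<close> lies below
  \<open>\<bar>z n - l\<bar>\<close> for every \<open>n\<close>, since \<open>z n\<close> is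
  positive; its norm is therefore 0.\<close>

lemma lim_nonneg_banach_lattice:
  fixes z :: "nat \<Rightarrow> 'a::banach_lattice"
  assumes "z \<longlonglongrightarrow> l" "\<And>n. 0 \<le> z n"
  shows "0 \<le> l"
proof -
  have "norm (sup (- l) 0) \<le> norm (z n - l)" for n
  proof -
    have "- l \<le> z n - l"
      using assms(2)[of n] by simp
    also have "\<dots> \<le> \<bar>z n - l\<bar>"
      by (rule abs_ge_self)
    finally have "\<bar>sup (- l) 0\<bar> \<le> \<bar>z n - l\<bar>"
      by simp
    then show ?thesis
      by (rule norm_mono_abs)
  qed
  moreover have "(\<lambda>n. norm (z n - l)) \<longlonglongrightarrow> 0"
    using assms(1) tendsto_norm_zero LIM_zero by blast
  ultimately have "norm (sup (- l) 0) \<le> 0"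
    by (meson LIMSEQ_le_const)
  then have "sup (- l) 0 = 0"
    by simp
  then show ?thesis
    by (metis neg_le_0_iff_le sup.cobounded1)
qed

lemma lim_le_banach_lattice:
  fixes y z :: "nat \<Rightarrow> 'a::banach_lattice"
  assumes "y \<longlonglongrightarrow> a" "z \<longlonglongrightarrow> b" "\<And>n. y n \<le> z n"
  shows "a \<le> b"
proof -
  have "0 \<le> b - a"
    by (rule lim_nonneg_banach_lattice[OF tendsto_diff[OF assms(2,1)]]) (simp add: assms(3))
  then show ?thesis
    by simp
qed

lemma member_le_sum_nonneg:
  fixes f :: "'i \<Rightarrow> 'a::ordered_comm_monoid_add"
  assumes "finite A" "i \<in> A" "\<And>j. j \<in> A \<Longrightarrow> 0 \<le> f j"
  shows "f i \<le> sum f A"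
  using sum_mono2[of A "{i}" f] assms by simp

section \<open>Maxima of partial sums\<close>

lemma abs_partial_sum_le_max:
  "n \<le> m \<Longrightarrow> \<bar>partial_sum \<alpha> x n\<bar> \<le> max_partial_sum \<alpha> x m"
  unfolding max_partial_sum_def by (intro Sup_fin.coboundedI) auto

lemma max_partial_sum_le:
  "(\<And>n. n \<le> m \<Longrightarrow> \<bar>partial_sum \<alpha> x n\<bar> \<le> c) \<Longrightarrow> max_partial_sum \<alpha> x m \<le> c"
  unfolding max_partial_sum_def by (intro Sup_fin.boundedI) auto

lemma max_partial_sum_nonneg: "0 \<le> max_partial_sum \<alpha> x m"
  by (meson abs_ge_zero abs_partial_sum_le_max order_refl order_trans)

lemma norm_max_partial_sum_le:
  assumes "\<And>n. n \<le> m \<Longrightarrow> \<bar>partial_sum \<alpha> x n\<bar> \<le> c"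
  shows "norm (max_partial_sum \<alpha> x m) \<le> norm c"
proof (rule norm_le_if_abs_le)
  show "\<bar>max_partial_sum \<alpha> x m\<bar> \<le> c"
    using max_partial_sum_le[OF assms] max_partial_sum_nonneg[of \<alpha> x m] by simp
qed

lemma sums_iff_partial_sum: "(\<lambda>k. \<alpha> k *\<^sub>R x k) sums y \<longleftrightarrow> partial_sum \<alpha> x \<longlonglongrightarrow> y"
  by (simp add: sums_def_le partial_sum_def[abs_def])

section \<open>Uniform, sigma-order and order convergence, and order boundedness\<close>

text \<open>Two things are missing for a dominating sequence: it must start at the first term and it
  must decrease. The regulator is enlarged for the former; for the latter, the tail from
  \<open>n\<close> on gets nearly its best multiple of the regulator, an infimum that can only fall
  as \<open>n\<close> grows.\<close>

lemma uniformly_converges_imp_sigma_order_converges: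
  fixes z :: "nat \<Rightarrow> 'a::banach_lattice"
  assumes "uniformly_converges z l"
  shows "sigma_order_converges z l"
proof -
  obtain e where e: "0 \<le> e"
    and conv: "\<And>\<epsilon>::real. \<epsilon> > 0 \<Longrightarrow> \<exists>n0. \<forall>n\<ge>n0. \<bar>z n - l\<bar> \<le> \<epsilon> *\<^sub>R e"
    using assms unfolding uniformly_converges_def by blast
  obtain N where N: "\<And>n. n \<ge> N \<Longrightarrow> \<bar>z n - l\<bar> \<le> e"
    using conv[of 1] by auto
  \<comment> \<open>The sum absorbs the finitely many terms that \<open>e\<close> does not
    dominate.\<close>
  define d where "d = e + (\<Sum>n<N. \<bar>z n - l\<bar>)"
  have ed: "e \<le> d"
    unfolding d_def by (simp add: sum_nonneg)
  have d: "0 \<le> d"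
    using e ed by simp
  have zd: "\<bar>z n - l\<bar> \<le> d" for n
  proof (cases "n < N")
    case True
    then have "\<bar>z n - l\<bar> \<le> (\<Sum>n<N. \<bar>z n - l\<bar>)"
      by (intro member_le_sum_nonneg[where f = "\<lambda>n. \<bar>z n - l\<bar>"]) auto
    then show ?thesis
      unfolding d_def using e by (simp add: add_increasing)
  next
    case False
    then show ?thesis
      using N[of n] ed by simp
  qed
  define T where "T n = {t. 0 \<le> t \<and> (\<forall>m\<ge>n. \<bar>z m - l\<bar> \<le> t *\<^sub>R d)}" for n
  \<comment> \<open>The summand \<open>1 / real (Suc n)\<close> vanishes in the limit and leaves an
    element of \<open>T n\<close> strictly below \<open>c n\<close>, whether or not the infimum is
    attained.\<close>
  define c where "c n = Inf (T n) + 1 / real (Suc n)" for n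
  have T1: "1 \<in> T n" for n
    using zd by (simp add: T_def)
  have bdd: "bdd_below (T n)" for n
    by (rule bdd_belowI[of _ 0]) (simp add: T_def)
  have Inf0: "0 \<le> Inf (T n)" for n
  proof (rule cInf_greatest)
    show "T n \<noteq> {}"
      using T1 by blast
  qed (simp add: T_def)
  have c0: "0 \<le> c n" for n
    using Inf0[of n] by (simp add: c_def)
  have zc: "\<bar>z n - l\<bar> \<le> c n *\<^sub>R d" for n
  proof -
    have "Inf (T n) < c n"
      by (simp add: c_def)
    then obtain t where "t \<in> T n" "t < c n"
      using T1[of n] cInf_lessD by blast
    then have "\<bar>z n - l\<bar> \<le> t *\<^sub>R d" "t *\<^sub>R d \<le> c n *\<^sub>R d"
      using d by (auto simp: T_def intro: scaleR_right_mono)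
    then show ?thesis
      by simp
  qed
  have "decseq c"
  proof (rule decseq_SucI)
    fix n
    have "Inf (T (Suc n)) \<le> Inf (T n)"
    proof (rule cInf_superset_mono[OF _ bdd])
      show "T n \<noteq> {}"
        using T1 by blast
    qed (auto simp: T_def)
    moreover have "1 / real (Suc (Suc n)) \<le> 1 / real (Suc n)"
      by (simp add: frac_le)
    ultimately show "c (Suc n) \<le> c n"
      unfolding c_def by linarith
  qed
  then have dec: "decseq (\<lambda>n. c n *\<^sub>R d)"
    using d by (auto simp: decseq_def intro: scaleR_right_mono)
  have "(\<lambda>n. Inf (T n)) \<longlonglongrightarrow> 0"
  proof (rule LIMSEQ_I)
    fix r :: real
    assume "r > 0"
    then obtain n0 where n0: "\<And>n. n \<ge> n0 \<Longrightarrow> \<bar>z n - l\<bar> \<le> (r / 2) *\<^sub>R e"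
      using conv[of "r / 2"] by auto
    have "norm (Inf (T n) - 0) < r" if "n \<ge> n0" for n
    proof -
      have "\<bar>z m - l\<bar> \<le> (r / 2) *\<^sub>R d" if "m \<ge> n" for m
        using n0[of m] that \<open>n \<ge> n0\<close> scaleR_left_mono[OF ed, of "r / 2"] \<open>r > 0\<close>
        by (meson half_gt_zero less_imp_le order_trans)
      then have "r / 2 \<in> T n"
        using \<open>r > 0\<close> by (simp add: T_def)
      then have "Inf (T n) \<le> r / 2"
        using bdd by (rule cInf_lower)
      then show ?thesis
        using Inf0[of n] \<open>r > 0\<close> by simp
    qed
    then show "\<exists>no. \<forall>n\<ge>no. norm (Inf (T n) - 0) < r"
      by blast
  qed
  then have "c \<longlonglongrightarrow> 0 + 0"
    unfolding c_def by (intro tendsto_add lim_1_over_n[THEN LIMSEQ_Suc])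
  then have "(\<lambda>n. c n *\<^sub>R d) \<longlonglongrightarrow> 0"
    using tendsto_scaleR[of c 0 sequentially "\<lambda>_. d" d] by simp
  \<comment> \<open>A lower bound stays below the norm limit because the cone is closed; this is the
    Archimedean property.\<close>
  then have "b \<le> 0" if "\<forall>n. b \<le> c n *\<^sub>R d" for b
    using lim_le_banach_lattice[of "\<lambda>_. b" b] that by auto
  moreover have "0 \<le> c n *\<^sub>R d" for n
    using c0 d by (simp add: scaleR_nonneg_nonneg)
  ultimately have "is_infimum (range (\<lambda>n. c n *\<^sub>R d)) 0"
    unfolding is_infimum_def by auto
  then show ?thesis
    unfolding sigma_order_converges_def using dec zc by blast
qed

text \<open>A decreasing sequence is a net over the natural numbers, and \<open>u i\<close>
  dominates all terms from index \<open>i\<close> on.\<close>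

lemma sigma_order_converges_imp_order_converges:
  assumes "sigma_order_converges z l"
  shows "order_converges z l"
proof -
  obtain u where u: "decseq u" "is_infimum (range u) 0" "\<And>n. \<bar>z n - l\<bar> \<le> u n"
    using assms unfolding sigma_order_converges_def by blast
  show ?thesis
  proof (rule order_convergesI_net)
    show "net_decreases_to UNIV {(i, j). i \<le> j} u 0"
      unfolding net_decreases_to_def
    proof (intro conjI)
      show "preorder_on UNIV {(i, j :: nat). i \<le> j}"
        by (auto simp: preorder_on_def refl_on_def trans_def)
      show "\<forall>i\<in>UNIV. \<forall>j\<in>UNIV. \<exists>k\<in>UNIV. (i, k) \<in> {(i, j :: nat). i \<le> j} \<and> (j, k) \<in> {(i, j). i \<le> j}"
        using nat_le_linear by auto
    qed (use u in \<open>auto simp: decseq_def\<close>)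
    show "\<forall>i\<in>UNIV. \<exists>n0. \<forall>n\<ge>n0. \<bar>z n - l\<bar> \<le> u i"
      using u(1,3) by (intro ballI exI allI impI) (rule order_trans, assumption, erule decseqD)
  qed
qed

text \<open>A single member of the dominating net bounds a tail; the finitely many earlier terms are
  bounded by the sum of their absolute values.\<close>

lemma order_converges_imp_abs_bounded:
  fixes z :: "nat \<Rightarrow> 'a::banach_lattice"
  assumes "order_converges z l"
  obtains c where "\<And>n. \<bar>z n\<bar> \<le> c"
proof -
  obtain u N where u: "\<And>n. n \<ge> N \<Longrightarrow> \<bar>z n - l\<bar> \<le> (u::'a)"
    using assms unfolding order_converges_def net_decreases_to_def by blast
  have "0 \<le> u"
    using u[of N] by (meson abs_ge_zero order_refl order_trans)
  define s where "s = (\<Sum>n<N. \<bar>z n\<bar>)"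
  have s: "0 \<le> s"
    unfolding s_def by (simp add: sum_nonneg)
  have "\<bar>z n\<bar> \<le> (\<bar>l\<bar> + u) + s" for n
  proof (cases "n < N")
    case True
    then have "\<bar>z n\<bar> \<le> s"
      unfolding s_def by (intro member_le_sum_nonneg[where f = "\<lambda>n. \<bar>z n\<bar>"]) auto
    then show ?thesis
      using \<open>0 \<le> u\<close> by (simp add: add_increasing)
  next
    case False
    have "\<bar>z n\<bar> = \<bar>l + (z n - l)\<bar>"
      by simp
    also have "\<dots> \<le> \<bar>l\<bar> + \<bar>z n - l\<bar>"
      by (rule abs_triangle_ineq)
    also have "\<dots> \<le> \<bar>l\<bar> + u"
      using False u[of n] by simp
    finally show ?thesis
      using s by (simp add: add_increasing2)
  qed
  then show ?thesis
    using that by blast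
qed

lemma order_bounded_range_iff:
  fixes z :: "nat \<Rightarrow> 'a::banach_lattice"
  shows "order_bounded (range z) \<longleftrightarrow> (\<exists>c. \<forall>n. \<bar>z n\<bar> \<le> c)"
proof
  assume "order_bounded (range z)"
  then obtain a b where ab: "\<And>n. a \<le> z n" "\<And>n. z n \<le> b"
    unfolding order_bounded_def by (metis atLeastAtMost_iff rangeI subsetD)
  have "\<bar>z n\<bar> \<le> sup b (- a)" for n
    using ab[of n] by (intro abs_leI) (auto intro: le_supI1 le_supI2)
  then show "\<exists>c. \<forall>n. \<bar>z n\<bar> \<le> c"
    by blast
next
  assume "\<exists>c. \<forall>n. \<bar>z n\<bar> \<le> c"
  then obtain c where c: "\<And>n. \<bar>z n\<bar> \<le> c"
    by blast
  have "- c \<le> z n \<and> z n \<le> c" for n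
    using c[of n] by (simp add: abs_le_iff minus_le_iff)
  then show "order_bounded (range z)"
    unfolding order_bounded_def by (intro exI[of _ "- c"] exI[of _ c]) auto
qed

section \<open>From the maximal inequality to uniform convergence\<close>

text \<open>The hypothesis \<open>blocks\<close> is what the maximal inequality says about the
  increments of a sequence after index \<open>N\<close>; in this form the choice of blocks is
  independent of series and coefficients.\<close>

lemma uniformly_convergesI_blocks:
  fixes z :: "nat \<Rightarrow> 'a::banach_lattice"
  assumes lim: "z \<longlonglongrightarrow> y" and "0 \<le> M"
    and blocks: "\<And>N n. N \<le> n \<Longrightarrow>
      \<exists>v. (\<forall>j. N \<le> j \<and> j \<le> n \<longrightarrow> \<bar>z j - z N\<bar> \<le> v) \<and> norm v \<le> M * norm (z n - z N)"
  shows "uniformly_converges z y"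
proof -
  \<comment> \<open>The half makes the distances of both ends of a block add up to
    \<open>(1/4) ^ i\<close>; the base 1/4 leaves \<open>(1/2) ^ i\<close> after multiplication by
    \<open>2 ^ i\<close>.\<close>
  have "\<exists>m. \<forall>n\<ge>m. norm (z n - y) < (1/4) ^ i / 2" for i
    using LIMSEQ_D[OF lim, of "(1/4) ^ i / 2"] by simp
  then obtain g where g: "\<And>i n. n \<ge> g i \<Longrightarrow> norm (z n - y) < (1/4) ^ i / 2"
    by metis
  define N where "N i = (\<Sum>j\<le>i. Suc (g j))" for i
  have "strict_mono N"
    by (simp add: strict_mono_Suc_iff N_def)
  have N: "norm (z n - y) < (1/4) ^ i / 2" if "n \<ge> N i" for i n
  proof (rule g)
    have "g i \<le> N i"
      unfolding N_def by (cases i) auto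
    then show "g i \<le> n"
      using that by simp
  qed
  have "\<forall>i. \<exists>v. (\<forall>j. N i \<le> j \<and> j \<le> N (Suc i) \<longrightarrow> \<bar>z j - z (N i)\<bar> \<le> v) \<and>
      norm v \<le> M * norm (z (N (Suc i)) - z (N i))"
    using blocks strict_monoD[OF \<open>strict_mono N\<close>, THEN less_imp_le] by blast
  then obtain v where v: "\<And>i j. N i \<le> j \<Longrightarrow> j \<le> N (Suc i) \<Longrightarrow> \<bar>z j - z (N i)\<bar> \<le> v i"
    and norm_v: "\<And>i. norm (v i) \<le> M * norm (z (N (Suc i)) - z (N i))"
    by metis
  \<comment> \<open>The extra summand turns the bound relative to the start of the block into one
    relative to the limit.\<close>
  define w where "w i = v i + \<bar>z (N i) - y\<bar>" for i
  have zw: "\<bar>z j - y\<bar> \<le> w i" if "N i \<le> j" "j \<le> N (Suc i)" for i j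
  proof -
    have "\<bar>z j - y\<bar> = \<bar>(z j - z (N i)) + (z (N i) - y)\<bar>"
      by simp
    also have "\<dots> \<le> \<bar>z j - z (N i)\<bar> + \<bar>z (N i) - y\<bar>"
      by (rule abs_triangle_ineq)
    also have "\<dots> \<le> w i"
      using v[OF that] by (simp add: w_def)
    finally show ?thesis .
  qed
  have N_le: "N i \<le> N (Suc i)" for i
    using \<open>strict_mono N\<close> by (simp add: strict_mono_less_eq)
  have w0: "0 \<le> w i" for i
    using zw[of i "N i"] N_le[of i] by (meson abs_ge_zero order_refl order_trans)
  have norm_w: "norm (w i) \<le> (M + 1) * (1/4) ^ i" for i
  proof -
    have "norm (z (N (Suc i)) - z (N i)) \<le> norm (z (N (Suc i)) - y) + norm (z (N i) - y)"
      by (metis dist_norm dist_triangle2)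
    also have "\<dots> \<le> (1/4) ^ i"
      using N[of i "N i"] N[OF N_le, of i] by simp
    finally have "norm (v i) \<le> M * (1/4) ^ i"
      using norm_v[of i] \<open>0 \<le> M\<close> by (meson mult_left_mono order_trans)
    moreover have "norm (z (N i) - y) \<le> (1/4) ^ i"
      using N[of i "N i"] norm_ge_zero[of "z (N i) - y"] by linarith
    ultimately show ?thesis
      unfolding w_def using norm_triangle_ineq[of "v i" "\<bar>z (N i) - y\<bar>"]
      by (simp add: algebra_simps)
  qed
  have summable: "summable (\<lambda>i. 2 ^ i *\<^sub>R w i)"
  proof (rule summable_comparison_test')
    show "summable (\<lambda>i. (M + 1) * (1/2) ^ i)"
      by (intro summable_mult summable_geometric) simp
    show "norm (2 ^ i *\<^sub>R w i) \<le> (M + 1) * (1/2) ^ i" for i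
    proof -
      have "2 ^ i * norm (w i) \<le> 2 ^ i * ((M + 1) * (1/4) ^ i)"
        by (intro mult_left_mono norm_w) simp
      also have "\<dots> = (M + 1) * (2 * (1/4)) ^ i"
        unfolding power_mult_distrib by simp
      finally show ?thesis
        by simp
    qed
  qed
  define e where "e = (\<Sum>i. 2 ^ i *\<^sub>R w i)"
  have term_nonneg: "0 \<le> (2 ^ i :: real) *\<^sub>R w i" for i
    using w0 by (simp add: scaleR_nonneg_nonneg)
  have e: "(\<lambda>n. \<Sum>i<n. 2 ^ i *\<^sub>R w i) \<longlonglongrightarrow> e"
    unfolding e_def using summable by (rule summable_LIMSEQ)
  then have e0: "0 \<le> e"
    by (rule lim_nonneg_banach_lattice) (simp add: sum_nonneg term_nonneg)
  \<comment> \<open>All summands are positive, so one of them lies below every partial sum that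
    contains it; the shift by \<open>Suc i\<close> keeps only such partial sums.\<close>
  have we: "2 ^ i *\<^sub>R w i \<le> e" for i
  proof (rule lim_le_banach_lattice[OF tendsto_const LIMSEQ_ignore_initial_segment[OF e, of "Suc i"]])
    show "2 ^ i *\<^sub>R w i \<le> (\<Sum>i<n + Suc i. 2 ^ i *\<^sub>R w i)" for n
      by (rule member_le_sum_nonneg) (auto intro: term_nonneg)
  qed
  have we': "w i \<le> (1/2) ^ i *\<^sub>R e" for i
    using scaleR_left_mono[OF we[of i], of "(1/2) ^ i"] by (simp flip: power_mult_distrib)
  show ?thesis
    unfolding uniformly_converges_def
  proof (intro exI[of _ e] conjI e0 allI impI)
    fix \<epsilon> :: real
    assume "\<epsilon> > 0"
    then obtain k where k: "(1/2) ^ k < \<epsilon>"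
      using real_arch_pow_inv[of \<epsilon> "1/2"] by auto
    have "\<bar>z n - y\<bar> \<le> \<epsilon> *\<^sub>R e" if n: "n \<ge> N k" for n
    proof -
      \<comment> \<open>\<open>N i\<close> is the right end of the block containing
        \<open>n\<close>; as \<open>n \<ge> N k\<close>, its predecessor \<open>j\<close> is at
        least \<open>k\<close>.\<close>
      define i where "i = (LEAST i. n < N i)"
      have ex: "n < N (Suc n)"
        using seq_suble[OF \<open>strict_mono N\<close>, of "Suc n"] by simp
      have "n < N i"
        unfolding i_def using ex by (rule LeastI)
      then have "k < i"
        using n \<open>strict_mono N\<close> by (meson le_less_trans strict_mono_less)
      then obtain j where j: "i = Suc j" "k \<le> j"
        by (cases i) auto
      have "N j \<le> n"
        using not_less_Least[of j "\<lambda>i. n < N i"] j(1) i_def by simp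
      then have "\<bar>z n - y\<bar> \<le> w j"
        using \<open>n < N i\<close> j(1) by (intro zw) auto
      also have "\<dots> \<le> (1/2) ^ j *\<^sub>R e"
        by (rule we')
      also have "\<dots> \<le> \<epsilon> *\<^sub>R e"
      proof (rule scaleR_right_mono[OF _ e0])
        have "(1/2 :: real) ^ j \<le> (1/2) ^ k"
          using j(2) by (intro power_decreasing) auto
        also have "\<dots> < \<epsilon>"
          by (rule k)
        finally show "(1/2) ^ j \<le> \<epsilon>"
          by (rule less_imp_le)
      qed
      finally show ?thesis .
    qed
    then show "\<exists>n0. \<forall>n\<ge>n0. \<bar>z n - y\<bar> \<le> \<epsilon> *\<^sub>R e"
      by blast
  qed
qed

text \<open>The maximal inequality holds for all coefficients, so deleting an initial segment of
  them turns increments into partial sums to which it applies.\<close>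

lemma maximal_inequality_imp_uniformly_converges:
  fixes x :: "nat \<Rightarrow> 'a::banach_lattice"
  assumes "0 \<le> M" and M: "\<And>m \<alpha>. norm (max_partial_sum \<alpha> x m) \<le> M * norm (partial_sum \<alpha> x m)"
    and lim: "partial_sum \<alpha> x \<longlonglongrightarrow> y"
  shows "uniformly_converges (partial_sum \<alpha> x) y"
proof (rule uniformly_convergesI_blocks[OF lim \<open>0 \<le> M\<close>])
  fix N n :: nat
  assume "N \<le> n"
  \<comment> \<open>Index \<open>N\<close> is deleted too, since \<open>partial_sum\<close> includes
    its last index.\<close>
  define \<beta> where "\<beta> k = (if k \<le> N then 0 else \<alpha> k)" for k
  have \<beta>: "partial_sum \<beta> x j = partial_sum \<alpha> x j - partial_sum \<alpha> x N" if "N \<le> j" for j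
    using that
  proof (induction j rule: dec_induct)
    case base
    show ?case
      by (simp add: partial_sum_def \<beta>_def)
  next
    case (step j)
    then show ?case
      by (simp add: partial_sum_def \<beta>_def)
  qed
  show "\<exists>v. (\<forall>j. N \<le> j \<and> j \<le> n \<longrightarrow> \<bar>partial_sum \<alpha> x j - partial_sum \<alpha> x N\<bar> \<le> v) \<and>
      norm v \<le> M * norm (partial_sum \<alpha> x n - partial_sum \<alpha> x N)"
  proof (intro exI[of _ "max_partial_sum \<beta> x n"] conjI allI impI)
    show "norm (max_partial_sum \<beta> x n) \<le> M * norm (partial_sum \<alpha> x n - partial_sum \<alpha> x N)"
      using M[of \<beta> n] \<beta>[OF \<open>N \<le> n\<close>] by simp
    show "\<bar>partial_sum \<alpha> x j - partial_sum \<alpha> x N\<bar> \<le> max_partial_sum \<beta> x n" if "N \<le> j \<and> j \<le> n" for j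
      using abs_partial_sum_le_max[of j n \<beta> x] \<beta>[of j] that by simp
  qed
qed

section \<open>Baire category and Zabreiko's lemma\<close>

text \<open>Baire's theorem inside \<open>S\<close>, which is complete because it is closed. The
  ball is taken relative to \<open>S\<close>, as a closed subspace may have empty interior in the
  whole space.\<close>

lemma closed_Union_closure_ball:
  fixes S :: "'a::complete_space set"
  assumes "closed S" "S \<noteq> {}" "S \<subseteq> (\<Union>n::nat. A n)"
  obtains n a r where "r > 0" "a \<in> S" "ball a r \<inter> S \<subseteq> closure (A n)"
proof -
  interpret Submetric UNIV "dist :: 'a \<Rightarrow> 'a \<Rightarrow> real" S
    by unfold_locales simp
  have complete: "sub.mcomplete"
    by (rule closedin_mcomplete_imp_mcomplete) (use assms(1) in \<open>auto simp: complete_UNIV\<close>)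
  let ?T = "\<lambda>n. S \<inter> closure (A n)"
  have "\<exists>n. sub.mtopology interior_of ?T n \<noteq> {}"
  proof (rule ccontr)
    assume empty: "\<nexists>n. sub.mtopology interior_of ?T n \<noteq> {}"
    have "sub.mtopology interior_of (\<Union>(range ?T)) = {}"
    proof (rule sub.metric_Baire_category_alt[OF complete])
      fix T
      assume "T \<in> range ?T"
      then show "closedin sub.mtopology T \<and> sub.mtopology interior_of T = {}"
        using empty by (auto simp: mtopology_submetric closedin_closed_Int)
    qed simp
    moreover have "\<Union>(range ?T) = S"
    proof (intro equalityI subsetI)
      fix y
      assume "y \<in> S"
      then obtain n where "y \<in> A n"
        using assms(3) by blast
      then show "y \<in> \<Union>(range ?T)"
        using \<open>y \<in> S\<close> closure_subset by blast
    qed auto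
    ultimately show False
      using \<open>S \<noteq> {}\<close> interior_of_topspace[of sub.mtopology] by simp
  qed
  then obtain n a r where "a \<in> S" "r > 0" "sub.mball a r \<subseteq> ?T n"
    unfolding sub.metric_interior_of by blast
  then have "ball a r \<inter> S \<subseteq> closure (A n)"
    by (auto simp: mball_submetric_eq)
  with \<open>a \<in> S\<close> \<open>r > 0\<close> show ?thesis
    using that by blast
qed

text \<open>
  Zabreiko's lemma. By Baire, the closure of some sublevel set of \<open>p\<close> contains a ball around
  \<open>0\<close>, and successive approximation writes every \<open>z\<close> in that ball as a series
  \<open>\<Sum>j. u j\<close> with \<open>p (u j) \<le> C / 2 ^ j\<close>.
\<close>

lemma countably_subadditive_bounded:
  fixes S :: "'a::banach set" and p :: "'a \<Rightarrow> real"
  assumes S: "subspace S" "closed S"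
    and p_nonneg: "\<And>y. y \<in> S \<Longrightarrow> 0 \<le> p y"
    and p_scale: "\<And>c y. y \<in> S \<Longrightarrow> p (c *\<^sub>R y) \<le> \<bar>c\<bar> * p y"
    and p_suminf: "\<And>y s. \<lbrakk>\<And>j. y j \<in> S; y sums s; summable (\<lambda>j. p (y j))\<rbrakk> \<Longrightarrow> p s \<le> (\<Sum>j. p (y j))"
  obtains M where "0 \<le> M" "\<And>y. y \<in> S \<Longrightarrow> p y \<le> M * norm y"
proof -
  have S0: "0 \<in> S"
    using S(1) by (rule subspace_0)
  have p0: "p 0 = 0"
    using p_scale[OF S0, of 0] p_nonneg[OF S0] by simp
  have p_add: "p (a + b) \<le> p a + p b" if "a \<in> S" "b \<in> S" for a b
  proof -
    \<comment> \<open>A sum of two vectors is a series padded with zeros, and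
      \<open>p 0 = 0\<close>.\<close>
    define y where "y j = (if j = 0 then a else if j = 1 then b else 0)" for j :: nat
    have y: "y sums (a + b)"
      using sums_finite[of "{0, 1}" y] by (simp add: y_def)
    have py: "(\<lambda>j. p (y j)) sums (p a + p b)"
      using sums_finite[of "{0, 1}" "\<lambda>j. p (y j)"] by (simp add: y_def p0)
    show ?thesis
      using p_suminf[OF _ y sums_summable[OF py]] sums_unique[OF py] that S0 by (simp add: y_def)
  qed
  define A where "A n = {u \<in> S. p u \<le> real n}" for n
  have "S \<subseteq> (\<Union>n. A n)"
    using real_arch_simple by (auto simp: A_def)
  moreover have "S \<noteq> {}"
    using S0 by blast
  ultimately obtain n a r where "r > 0" "a \<in> S" and ball: "ball a r \<inter> S \<subseteq> closure (A n)"
    using closed_Union_closure_ball[OF S(2)] by metis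
  define C where "C = real n"
  have C: "0 \<le> C"
    by (simp add: C_def)
  \<comment> \<open>Symmetrization moves the ball from \<open>a\<close> to 0: if \<open>u\<close>
    and \<open>v\<close> approximate \<open>a + z\<close> and \<open>a - z\<close>, then half of
    \<open>u - v\<close> approximates \<open>z\<close>, and \<open>p\<close> stays below the same
    level \<open>C\<close>.\<close>
  have approx: "\<exists>u\<in>S. p u \<le> C \<and> norm (z - u) < e" if z: "z \<in> S" "norm z < r" and "e > 0" for z e
  proof -
    have "a + z \<in> closure (A n)" "a - z \<in> closure (A n)"
      using ball z \<open>a \<in> S\<close> S(1)
      by (auto simp: subset_iff dist_norm subspace_add subspace_diff)
    then obtain u v where u: "u \<in> A n" "dist u (a + z) < e" and v: "v \<in> A n" "dist v (a - z) < e"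
      using \<open>e > 0\<close> closure_approachable by metis
    define w where "w = (1/2) *\<^sub>R (u + (-1) *\<^sub>R v)"
    have S': "u \<in> S" "v \<in> S" "(-1) *\<^sub>R v \<in> S" "u + (-1) *\<^sub>R v \<in> S" "w \<in> S"
      using u v S(1) unfolding w_def A_def by (auto intro!: subspace_diff subspace_scale subspace_neg)
    have "p w \<le> 1/2 * p (u + (-1) *\<^sub>R v)"
      unfolding w_def using p_scale[OF S'(4), of "1/2"] by simp
    also have "\<dots> \<le> 1/2 * (p u + p ((-1) *\<^sub>R v))"
      using p_add[OF S'(1,3)] by simp
    also have "\<dots> \<le> 1/2 * (p u + p v)"
      using p_scale[OF S'(2), of "-1"] by simp
    also have "\<dots> \<le> C"
      using u v by (simp add: A_def C_def)
    finally have "p w \<le> C" .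
    moreover have "norm (z - w) < e"
    proof -
      have "z - w = (1/2) *\<^sub>R ((a + z - u) - (a - z - v))"
        by (simp add: w_def algebra_simps flip: scaleR_add_left)
      then have "norm (z - w) = 1/2 * norm ((a + z - u) - (a - z - v))"
        by simp
      also have "\<dots> \<le> 1/2 * (norm (a + z - u) + norm (a - z - v))"
        by (intro mult_left_mono norm_triangle_ineq4) simp
      also have "\<dots> < e"
        using u(2) v(2) by (simp add: dist_norm norm_minus_commute)
      finally show ?thesis .
    qed
    ultimately show ?thesis
      using S'(5) by blast
  qed
  have approx_scaled: "\<exists>u\<in>S. p u \<le> C / 2 ^ k \<and> norm (z - u) < r / 2 ^ Suc k"
    if z: "z \<in> S" "norm z < r / 2 ^ k" for z k
  proof -
    have "norm ((2 ^ k :: real) *\<^sub>R z) < r"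
      using z(2) by (simp add: field_simps)
    then obtain u where u: "u \<in> S" "p u \<le> C" "norm ((2 ^ k :: real) *\<^sub>R z - u) < r / 2"
      using approx[of "(2 ^ k :: real) *\<^sub>R z" "r / 2"] z(1) S(1) \<open>r > 0\<close> by (auto intro: subspace_scale)
    define v where "v = (1 / 2 ^ k :: real) *\<^sub>R u"
    have "p v \<le> 1 / 2 ^ k * p u"
      unfolding v_def using p_scale[OF u(1), of "1 / 2 ^ k"] by simp
    also have "\<dots> \<le> C / 2 ^ k"
      using u(2) by (simp add: divide_right_mono)
    finally have "p v \<le> C / 2 ^ k" .
    moreover have "z - v = (1 / 2 ^ k :: real) *\<^sub>R ((2 ^ k :: real) *\<^sub>R z - u)"
      by (simp add: v_def scaleR_diff_right)
    then have "norm (z - v) = norm ((2 ^ k :: real) *\<^sub>R z - u) / 2 ^ k"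
      by simp
    then have "norm (z - v) < r / 2 ^ Suc k"
      using u(3) by (simp add: field_simps)
    moreover have "v \<in> S"
      unfolding v_def using u(1) S(1) by (rule subspace_scale[rotated])
    ultimately show ?thesis
      by blast
  qed
  have small: "p z \<le> 2 * C" if z: "z \<in> S" "norm z < r" for z
  proof -
    \<comment> \<open>\<open>R k\<close> is the remainder after \<open>k\<close> approximations; the
      clause for \<open>k = 0\<close> pins the starting value to \<open>z\<close>.\<close>
    have "\<exists>R. \<forall>k. (R k \<in> S \<and> norm (R k) < r / 2 ^ k \<and> (k = 0 \<longrightarrow> R k = z)) \<and>
        p (R k - R (Suc k)) \<le> C / 2 ^ k"
    proof (rule dependent_nat_choice)
      fix w k
      assume w: "w \<in> S \<and> norm w < r / 2 ^ k \<and> (k = 0 \<longrightarrow> w = z)"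
      then obtain u where "u \<in> S" "p u \<le> C / 2 ^ k" "norm (w - u) < r / 2 ^ Suc k"
        using approx_scaled by blast
      then show "\<exists>y. (y \<in> S \<and> norm y < r / 2 ^ Suc k \<and> (Suc k = 0 \<longrightarrow> y = z)) \<and> p (w - y) \<le> C / 2 ^ k"
        using w S(1) by (intro exI[of _ "w - u"]) (simp add: subspace_diff)
    qed (use z in auto)
    then obtain R where R: "\<And>k. R k \<in> S" "\<And>k. norm (R k) < r / 2 ^ k" "R 0 = z"
      and pR: "\<And>k. p (R k - R (Suc k)) \<le> C / 2 ^ k"
      by blast
    have RS: "R k - R (Suc k) \<in> S" for k
      using R(1) S(1) by (simp add: subspace_diff)
    have "R \<longlonglongrightarrow> 0"
    proof (rule Lim_null_comparison)
      show "\<forall>\<^sub>F k in sequentially. norm (R k) \<le> r / 2 ^ k"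
        using R(2) by (intro always_eventually allI less_imp_le)
      show "(\<lambda>k. r / 2 ^ k) \<longlonglongrightarrow> 0"
        using tendsto_mult_right_zero[OF LIMSEQ_power_zero[of "1/2 :: real"], of r]
        by (simp add: power_divide)
    qed
    then have sums: "(\<lambda>k. R k - R (Suc k)) sums z"
      using telescope_sums'[of R 0] R(3) by simp
    have geo: "(\<lambda>k. C / 2 ^ k) sums (2 * C)"
      using sums_mult[OF geometric_sums[of "1/2 :: real"], of C] by (simp add: power_divide mult.commute)
    have summ: "summable (\<lambda>k. p (R k - R (Suc k)))"
      using pR p_nonneg[OF RS] by (intro summable_comparison_test'[OF sums_summable[OF geo]]) simp
    have "p z \<le> (\<Sum>k. p (R k - R (Suc k)))"
      by (rule p_suminf[OF RS sums summ])
    also have "\<dots> \<le> (\<Sum>k. C / 2 ^ k)"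
      using pR summ sums_summable[OF geo] by (rule suminf_le)
    also have "\<dots> = 2 * C"
      using geo by (simp add: sums_iff)
    finally show ?thesis .
  qed
  show ?thesis
  proof (rule that)
    \<comment> \<open>A nonzero \<open>y\<close> is scaled to norm \<open>r / 2\<close>, where
      \<open>p\<close> is at most \<open>2 * C\<close>; scaling back costs the factor
      \<open>2 * norm y / r\<close>.\<close>
    show "0 \<le> 4 * C / r"
      using C \<open>r > 0\<close> by simp
    fix y
    assume y: "y \<in> S"
    show "p y \<le> 4 * C / r * norm y"
    proof (cases "y = 0")
      case True
      then show ?thesis
        by (simp add: p0)
    next
      case False
      define z where "z = (r / (2 * norm y)) *\<^sub>R y"
      have "z \<in> S" "norm z < r"
        using y S(1) False \<open>r > 0\<close> by (auto simp: z_def subspace_scale)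
      then have "p z \<le> 2 * C"
        by (rule small)
      have "y = (2 * norm y / r) *\<^sub>R z"
        using False \<open>r > 0\<close> by (simp add: z_def)
      then have "p y \<le> \<bar>2 * norm y / r\<bar> * p z"
        using p_scale[OF \<open>z \<in> S\<close>, of "2 * norm y / r"] by simp
      also have "\<dots> \<le> \<bar>2 * norm y / r\<bar> * (2 * C)"
        using \<open>p z \<le> 2 * C\<close> by (rule mult_left_mono) simp
      also have "\<dots> = 4 * C / r * norm y"
        using \<open>r > 0\<close> by simp
      finally show ?thesis .
    qed
  qed
qed

section \<open>Expansions along a basic sequence and the maximal inequality\<close>

text \<open>Each term is a difference of consecutive partial sums. For \<open>x k \<noteq> 0\<close>
  this bounds the coefficient itself, which stands in for continuity of the coefficient
  functionals.\<close>

lemma norm_scaleR_le_max_partial_sum: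
  fixes x :: "nat \<Rightarrow> 'a::banach_lattice"
  assumes "\<And>m. norm (max_partial_sum \<alpha> x m) \<le> B"
  shows "norm (\<alpha> k *\<^sub>R x k) \<le> 2 * B"
proof -
  have le: "norm (partial_sum \<alpha> x n) \<le> B" for n
    using norm_le_if_abs_le[OF abs_partial_sum_le_max[of n n \<alpha> x]] assms[of n] by simp
  show ?thesis
  proof (cases k)
    case 0
    have "norm (partial_sum \<alpha> x 0) \<le> 2 * B"
      using le[of 0] norm_ge_zero[of "partial_sum \<alpha> x 0"] by linarith
    then show ?thesis
      by (simp add: partial_sum_def 0)
  next
    case (Suc j)
    have "\<alpha> k *\<^sub>R x k = partial_sum \<alpha> x (Suc j) - partial_sum \<alpha> x j"
      by (simp add: partial_sum_def Suc)
    also have "norm \<dots> \<le> B + B"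
      by (intro order_trans[OF norm_triangle_ineq4] add_mono le)
    finally show ?thesis
      by simp
  qed
qed

lemma subspace_closure:
  fixes S :: "'a::real_normed_vector set"
  assumes "subspace S"
  shows "subspace (closure S)"
proof (rule subspaceI)
  show "0 \<in> closure S"
    using subspace_0[OF assms] closure_subset by blast
next
  fix a b
  assume "a \<in> closure S" "b \<in> closure S"
  then obtain f g where "\<And>n. f n \<in> S" "f \<longlonglongrightarrow> a" "\<And>n. g n \<in> S" "g \<longlonglongrightarrow> b"
    unfolding closure_sequential by blast
  then show "a + b \<in> closure S"
    unfolding closure_sequential using assms
    by (intro exI[of _ "\<lambda>n. f n + g n"]) (simp add: subspace_add tendsto_add)
next
  fix c a
  assume "a \<in> closure S"
  then obtain f where "\<And>n. f n \<in> S" "f \<longlonglongrightarrow> a"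
    unfolding closure_sequential by blast
  then show "c *\<^sub>R a \<in> closure S"
    unfolding closure_sequential using assms
    by (intro exI[of _ "\<lambda>n. c *\<^sub>R f n"]) (simp add: subspace_scale tendsto_scaleR)
qed

lemma sums_in_closure_span:
  fixes x :: "nat \<Rightarrow> 'a::real_normed_vector"
  assumes "(\<lambda>k. \<alpha> k *\<^sub>R x k) sums y"
  shows "y \<in> closure (span (range x))"
  unfolding closure_sequential
proof (intro exI conjI allI)
  show "(\<lambda>n. \<Sum>k<n. \<alpha> k *\<^sub>R x k) \<longlonglongrightarrow> y"
    using assms by (simp add: sums_def)
  show "(\<Sum>k<n. \<alpha> k *\<^sub>R x k) \<in> span (range x)" for n
    by (intro span_sum span_scale span_base) simp
qed

lemma basic_sequence_unique:
  assumes "basic_sequence x" "(\<lambda>k. \<alpha> k *\<^sub>R x k) sums y" "(\<lambda>k. \<beta> k *\<^sub>R x k) sums y"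
  shows "\<alpha> = \<beta>"
proof -
  have "\<exists>!\<alpha>. (\<lambda>k. \<alpha> k *\<^sub>R x k) sums y"
    using assms(1) sums_in_closure_span[OF assms(2)] unfolding basic_sequence_def by blast
  then show ?thesis
  proof (rule ex1E)
    fix \<gamma>
    assume "\<forall>\<beta>. (\<lambda>k. \<beta> k *\<^sub>R x k) sums y \<longrightarrow> \<beta> = \<gamma>"
    note unique = this[rule_format]
    show ?thesis
      using unique[OF assms(2)] unique[OF assms(3)] by simp
  qed
qed

text \<open>Otherwise the zero sequence and a unit sequence would be two expansions of 0.\<close>

lemma basic_sequence_nonzero:
  assumes "basic_sequence x"
  shows "x k \<noteq> 0"
proof
  assume "x k = 0"
  have zero: "(\<lambda>j. 0 *\<^sub>R x j) sums 0"
    by simp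
  have "(\<lambda>j. (if j = k then 1 else 0 :: real) *\<^sub>R x j) = (\<lambda>j. 0)"
    using \<open>x k = 0\<close> by auto
  then have delta: "(\<lambda>j. (if j = k then 1 else 0) *\<^sub>R x j) sums 0"
    by simp
  from fun_cong[OF basic_sequence_unique[OF assms zero delta], of k] show False
    by simp
qed

text \<open>
  Zabreiko's lemma is applied to \<open>p y = (SUP m. norm (max_partial_sum (c y) x m))\<close>, where \<open>c y\<close>
  are the coefficients of \<open>y\<close>. Since \<open>p\<close> dominates the coefficients, this does not need
  the continuity of the basis projections.
\<close>

lemma pointwise_bounded_imp_maximal_inequality:
  fixes x :: "nat \<Rightarrow> 'a::banach_lattice"
  assumes basic: "basic_sequence x"
    and bounded: "\<And>\<alpha>. convergent (partial_sum \<alpha> x) \<Longrightarrow> bounded (range (max_partial_sum \<alpha> x))"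
  obtains M where "0 \<le> M" "\<And>m \<alpha>. norm (max_partial_sum \<alpha> x m) \<le> M * norm (partial_sum \<alpha> x m)"
proof -
  define S where "S = closure (span (range x))"
  obtain c where c: "\<And>y. y \<in> S \<Longrightarrow> (\<lambda>k. c y k *\<^sub>R x k) sums y"
    using basic unfolding basic_sequence_def S_def by metis
  have c_unique: "c y = \<alpha>" if "(\<lambda>k. \<alpha> k *\<^sub>R x k) sums y" for y \<alpha>
    using basic_sequence_unique[OF basic c that] sums_in_closure_span[OF that] by (simp add: S_def)
  have S: "subspace S" "closed S"
    unfolding S_def by (simp_all add: subspace_closure)
  define p where "p y = (SUP m. norm (max_partial_sum (c y) x m))" for y
  have le_p: "norm (max_partial_sum (c y) x m) \<le> p y" if "y \<in> S" for y m
  proof -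
    have "convergent (partial_sum (c y) x)"
      using c[OF that] unfolding sums_iff_partial_sum by (rule convergentI)
    then obtain B where "\<And>m. norm (max_partial_sum (c y) x m) \<le> B"
      using bounded unfolding bounded_iff by blast
    then show ?thesis
      unfolding p_def by (intro cSUP_upper bdd_aboveI2) auto
  qed
  have p_le: "p y \<le> B" if "\<And>m. norm (max_partial_sum (c y) x m) \<le> B" for y B
    unfolding p_def using that by (intro cSUP_least) auto
  have p_nonneg: "0 \<le> p y" if "y \<in> S" for y
    using le_p[OF that, of 0] norm_ge_zero order_trans by blast
  have p_scale: "p (a *\<^sub>R y) \<le> \<bar>a\<bar> * p y" if y: "y \<in> S" for a y
  proof (rule p_le)
    fix m
    have "(\<lambda>k. a *\<^sub>R (c y k *\<^sub>R x k)) sums (a *\<^sub>R y)"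
      using c[OF y] by (rule sums_scaleR_right)
    then have ca: "c (a *\<^sub>R y) = (\<lambda>k. a * c y k)"
      by (intro c_unique) simp
    have "\<bar>partial_sum (c (a *\<^sub>R y)) x n\<bar> \<le> \<bar>a\<bar> *\<^sub>R max_partial_sum (c y) x m" if "n \<le> m" for n
    proof -
      have "partial_sum (c (a *\<^sub>R y)) x n = a *\<^sub>R partial_sum (c y) x n"
        by (simp add: ca partial_sum_def scaleR_sum_right)
      then have "\<bar>partial_sum (c (a *\<^sub>R y)) x n\<bar> \<le> \<bar>a\<bar> *\<^sub>R \<bar>partial_sum (c y) x n\<bar>"
        by (simp add: abs_scaleR_le)
      also have "\<dots> \<le> \<bar>a\<bar> *\<^sub>R max_partial_sum (c y) x m"
        using that by (intro scaleR_left_mono abs_partial_sum_le_max) auto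
      finally show ?thesis .
    qed
    then have "norm (max_partial_sum (c (a *\<^sub>R y)) x m) \<le> norm (\<bar>a\<bar> *\<^sub>R max_partial_sum (c y) x m)"
      by (rule norm_max_partial_sum_le)
    also have "\<dots> \<le> \<bar>a\<bar> * p y"
      using le_p[OF y, of m] by (simp add: mult_left_mono)
    finally show "norm (max_partial_sum (c (a *\<^sub>R y)) x m) \<le> \<bar>a\<bar> * p y" .
  qed
  have p_suminf: "p s \<le> (\<Sum>j. p (y j))"
    if y: "\<And>j. y j \<in> S" and s: "y sums s" and summ: "summable (\<lambda>j. p (y j))" for y s
  proof -
    define P where "P j n = partial_sum (c (y j)) x n" for j n
    \<comment> \<open>The candidate coefficients of \<open>s\<close>; these scalar series converge
      because each coefficient is at most \<open>2 * p (y j) / norm (x k)\<close> in absolute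
      value.\<close>
    define \<beta> where "\<beta> k = (\<Sum>j. c (y j) k)" for k
    have "summable (\<lambda>j. c (y j) k)" for k
    proof (rule summable_comparison_test')
      show "summable (\<lambda>j. 2 * p (y j) / norm (x k))"
        by (intro summable_divide summable_mult summ)
      show "norm (c (y j) k) \<le> 2 * p (y j) / norm (x k)" for j
        using norm_scaleR_le_max_partial_sum[OF le_p[OF y[of j]], of k]
          basic_sequence_nonzero[OF basic, of k]
        by (simp add: field_simps)
    qed
    then have "(\<lambda>j. c (y j) k *\<^sub>R x k) sums (\<beta> k *\<^sub>R x k)" for k
      unfolding \<beta>_def by (intro sums_scaleR_left summable_sums)
    then have P_sums: "(\<lambda>j. P j n) sums partial_sum \<beta> x n" for n
      unfolding P_def partial_sum_def by (intro sums_sum)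
    have P_lim: "P j \<longlonglongrightarrow> y j" for j
      using c[OF y[of j]] unfolding sums_iff_partial_sum P_def[abs_def] .
    have "norm (P j n) \<le> p (y j)" for j n
      using norm_le_if_abs_le[OF abs_partial_sum_le_max[of n n "c (y j)" x]] le_p[OF y[of j], of n]
      unfolding P_def by simp
    \<comment> \<open>The bound \<open>p (y j)\<close> does not depend on \<open>n\<close>, so the
      limits in \<open>N\<close> and \<open>n\<close> may be interchanged; this shows that
      \<open>\<beta>\<close> really expands \<open>s\<close>.\<close>
    then have "uniform_limit UNIV (\<lambda>N n. \<Sum>j<N. P j n) (\<lambda>n. \<Sum>j. P j n) sequentially"
      using summ by (intro Weierstrass_m_test) auto
    moreover have "(\<lambda>n. \<Sum>j. P j n) = partial_sum \<beta> x"
      using P_sums by (auto simp: sums_iff)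
    ultimately have unif: "uniform_limit UNIV (\<lambda>N n. \<Sum>j<N. P j n) (partial_sum \<beta> x) sequentially"
      by simp
    have "partial_sum \<beta> x \<longlonglongrightarrow> s"
    proof (rule swap_uniform_limit'[OF _ _ unif])
      show "\<forall>\<^sub>F N in sequentially. (\<lambda>n. \<Sum>j<N. P j n) \<longlonglongrightarrow> (\<Sum>j<N. y j)"
        by (intro always_eventually allI tendsto_sum P_lim)
      show "(\<lambda>N. \<Sum>j<N. y j) \<longlonglongrightarrow> s"
        using s by (simp add: sums_def)
    qed auto
    then have cs: "c s = \<beta>"
      by (intro c_unique) (simp add: sums_iff_partial_sum)
    show ?thesis
    proof (rule p_le)
      fix m
      \<comment> \<open>The maxima of the pieces sum to one element that dominates all partial sums
        of \<open>s\<close> up to \<open>m\<close>.\<close>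
      define w where "w j = max_partial_sum (c (y j)) x m" for j
      have w_le: "norm (w j) \<le> p (y j)" for j
        unfolding w_def by (rule le_p[OF y])
      have norm_w: "summable (\<lambda>j. norm (w j))"
        using w_le by (intro summable_comparison_test'[OF summ]) simp
      have w: "(\<lambda>N. \<Sum>j<N. w j) \<longlonglongrightarrow> suminf w"
        by (rule summable_LIMSEQ[OF summable_norm_cancel[OF norm_w]])
      have "\<bar>partial_sum (c s) x n\<bar> \<le> suminf w" if "n \<le> m" for n
      proof (rule abs_leI)
        have Pw: "\<bar>P j n\<bar> \<le> w j" for j
          unfolding P_def w_def using that by (rule abs_partial_sum_le_max)
        have lim: "(\<lambda>N. \<Sum>j<N. P j n) \<longlonglongrightarrow> partial_sum (c s) x n"
          using P_sums by (simp add: sums_def cs)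
        show "partial_sum (c s) x n \<le> suminf w"
          using Pw by (intro lim_le_banach_lattice[OF lim w] sum_mono) (auto simp: abs_le_iff)
        show "- partial_sum (c s) x n \<le> suminf w"
        proof (rule lim_le_banach_lattice[OF tendsto_minus[OF lim] w])
          show "- (\<Sum>j<N. P j n) \<le> (\<Sum>j<N. w j)" for N
            unfolding sum_negf[symmetric] using Pw by (intro sum_mono) (auto simp: abs_le_iff)
        qed
      qed
      then have "norm (max_partial_sum (c s) x m) \<le> norm (suminf w)"
        by (rule norm_max_partial_sum_le)
      also have "\<dots> \<le> (\<Sum>j. norm (w j))"
        using norm_w by (rule summable_norm)
      also have "\<dots> \<le> (\<Sum>j. p (y j))"
        using w_le norm_w summ by (rule suminf_le)
      finally show "norm (max_partial_sum (c s) x m) \<le> (\<Sum>j. p (y j))" .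
    qed
  qed
  obtain M where M: "0 \<le> M" "\<And>y. y \<in> S \<Longrightarrow> p y \<le> M * norm y"
    using countably_subadditive_bounded[OF S p_nonneg p_scale p_suminf] by blast
  show ?thesis
  proof (rule that[OF M(1)])
    fix m and \<alpha> :: "nat \<Rightarrow> real"
    \<comment> \<open>A finite sum is a vector of \<open>S\<close> whose coefficients are the
      truncated ones; up to index \<open>m\<close> the truncation changes no partial sum, so
      \<open>p\<close> of this vector bounds the maximum.\<close>
    define \<beta> where "\<beta> k = (if k \<le> m then \<alpha> k else 0)" for k
    have "(\<lambda>k. \<beta> k *\<^sub>R x k) sums (\<Sum>k\<le>m. \<beta> k *\<^sub>R x k)"
      by (rule sums_finite) (auto simp: \<beta>_def)
    also have "(\<Sum>k\<le>m. \<beta> k *\<^sub>R x k) = partial_sum \<alpha> x m"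
      by (simp add: partial_sum_def \<beta>_def)
    finally have sums: "(\<lambda>k. \<beta> k *\<^sub>R x k) sums partial_sum \<alpha> x m" .
    have "partial_sum \<beta> x n = partial_sum \<alpha> x n" if "n \<le> m" for n
      unfolding partial_sum_def using that by (intro sum.cong) (auto simp: \<beta>_def)
    then have "max_partial_sum \<alpha> x m = max_partial_sum (c (partial_sum \<alpha> x m)) x m"
      unfolding max_partial_sum_def c_unique[OF sums] by (auto intro!: arg_cong[where f = Sup_fin])
    then show "norm (max_partial_sum \<alpha> x m) \<le> M * norm (partial_sum \<alpha> x m)"
      using le_p[of "partial_sum \<alpha> x m" m] M(2)[of "partial_sum \<alpha> x m"]
        sums_in_closure_span[OF sums] unfolding S_def by simp
  qed
qed

section \<open>The cycle of implications\<close>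

lemma all_equivalent_cycle:
  assumes "P1 \<Longrightarrow> P2" "P2 \<Longrightarrow> P3" "P3 \<Longrightarrow> P4" "P4 \<Longrightarrow> P5" "P5 \<Longrightarrow> P6" "P6 \<Longrightarrow> P1"
  shows "all_equivalent [P1, P2, P3, P4, P5, P6]"
proof -
  have "P1 \<longleftrightarrow> P6" "P2 \<longleftrightarrow> P6" "P3 \<longleftrightarrow> P6" "P4 \<longleftrightarrow> P6" "P5 \<longleftrightarrow> P6"
    using assms by blast+
  then show ?thesis
    by (simp add: all_equivalent_def)
qed

theorem theorem2p1:
  fixes x :: "nat \<Rightarrow> 'a::banach_lattice"
  assumes "basic_sequence x"
  shows "all_equivalent
    [\<forall>\<alpha> y. partial_sum \<alpha> x \<longlonglongrightarrow> y \<longrightarrow> uniformly_converges (partial_sum \<alpha> x) y,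
     \<forall>\<alpha> y. partial_sum \<alpha> x \<longlonglongrightarrow> y \<longrightarrow> sigma_order_converges (partial_sum \<alpha> x) y,
     \<forall>\<alpha> y. partial_sum \<alpha> x \<longlonglongrightarrow> y \<longrightarrow> order_converges (partial_sum \<alpha> x) y,
     \<forall>\<alpha>. convergent (partial_sum \<alpha> x) \<longrightarrow> order_bounded (range (partial_sum \<alpha> x)),
     \<forall>\<alpha>. convergent (partial_sum \<alpha> x) \<longrightarrow> bounded (range (max_partial_sum \<alpha> x)),
     \<exists>M\<ge>1. \<forall>m \<alpha>. norm (max_partial_sum \<alpha> x m) \<le> M * norm (partial_sum \<alpha> x m)]"
proof (rule all_equivalent_cycle)
  assume order: "\<forall>\<alpha> y. partial_sum \<alpha> x \<longlonglongrightarrow> y \<longrightarrow> order_converges (partial_sum \<alpha> x) y"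
  show "\<forall>\<alpha>. convergent (partial_sum \<alpha> x) \<longrightarrow> order_bounded (range (partial_sum \<alpha> x))"
  proof (intro allI impI)
    fix \<alpha>
    assume "convergent (partial_sum \<alpha> x)"
    then obtain y where "order_converges (partial_sum \<alpha> x) y"
      using order unfolding convergent_def by blast
    then show "order_bounded (range (partial_sum \<alpha> x))"
      unfolding order_bounded_range_iff using order_converges_imp_abs_bounded by metis
  qed
next
  assume bounded: "\<forall>\<alpha>. convergent (partial_sum \<alpha> x) \<longrightarrow> order_bounded (range (partial_sum \<alpha> x))"
  show "\<forall>\<alpha>. convergent (partial_sum \<alpha> x) \<longrightarrow> bounded (range (max_partial_sum \<alpha> x))"
  proof (intro allI impI)
    fix \<alpha>
    assume "convergent (partial_sum \<alpha> x)"
    then obtain c where "\<And>n. \<bar>partial_sum \<alpha> x n\<bar> \<le> c"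
      using bounded unfolding order_bounded_range_iff by blast
    then have "norm (max_partial_sum \<alpha> x m) \<le> norm c" for m
      by (intro norm_max_partial_sum_le)
    then show "bounded (range (max_partial_sum \<alpha> x))"
      unfolding bounded_iff by blast
  qed
next
  assume "\<forall>\<alpha>. convergent (partial_sum \<alpha> x) \<longrightarrow> bounded (range (max_partial_sum \<alpha> x))"
  then obtain M where M: "\<And>m \<alpha>. norm (max_partial_sum \<alpha> x m) \<le> M * norm (partial_sum \<alpha> x m)"
    using pointwise_bounded_imp_maximal_inequality[OF assms] by metis
  have "norm (max_partial_sum \<alpha> x m) \<le> max 1 M * norm (partial_sum \<alpha> x m)" for m \<alpha>
    using M[of \<alpha> m] by (rule order_trans) (simp add: mult_right_mono)
  then show "\<exists>M\<ge>1. \<forall>m \<alpha>. norm (max_partial_sum \<alpha> x m) \<le> M * norm (partial_sum \<alpha> x m)"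
    by (intro exI[of _ "max 1 M"]) simp
next
  assume "\<exists>M\<ge>1. \<forall>m \<alpha>. norm (max_partial_sum \<alpha> x m) \<le> M * norm (partial_sum \<alpha> x m)"
  then obtain M where "0 \<le> M" "\<And>m \<alpha>. norm (max_partial_sum \<alpha> x m) \<le> M * norm (partial_sum \<alpha> x m)"
    by (meson order_trans zero_le_one)
  then show "\<forall>\<alpha> y. partial_sum \<alpha> x \<longlonglongrightarrow> y \<longrightarrow> uniformly_converges (partial_sum \<alpha> x) y"
    using maximal_inequality_imp_uniformly_converges by blast
qed (simp_all add: uniformly_converges_imp_sigma_order_converges
      sigma_order_converges_imp_order_converges)

end
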